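(* Let $X$ be a complex Banach space and let $E,F\in L(X)$ be two invertible and positive operators. Suppose in addition that $T\in L(X)$ is such that $T^\dag_{E,F}$ and $T^{\sharp}$ exist. Then the following statements are equivalent: (i) $T$ is weighted EP with weights $E$ and $F$; (ii) $R(T^\dag_{E,F})=R(T)$ and $N(T^\dag_{E,F})=N(T)$; (iii) $R(T^\dag_{E,F})\subseteq R(T)$ and $N(T)\subseteq N(T^\dag_{E,F})$; (iv) $R(T)\subseteq R(T^\dag_{E,F})$ and $N(T)\subseteq N(T^\dag_{E,F})$; (v) $R(T^\dag_{E,F})\subseteq R(T)$ and $N(T^\dag_{E,F})\subseteq N(T)$; (vi) $R(T)\subseteq R(T^\dag_{E,F})$ and $N(T^\dag_{E,F})\subseteq N(T)$; (vii) $T^\dag_{E,F}=T^{\sharp}$; (viii) $T^\dag_{E,F}=T(T^\dag_{E,F})^2=(T^\dag_{E,F})^2T$; (ix) $T=T^\dag_{E,F}T^2=T^2T^\dag_{E,F}$; (x) $T^\dag_{E,F}$ is weighted EP with weights $F$ and $E$, moreover $(T^\dag_{E,F})^{\dag}_{F,E}=T$; (xi) $T$ is weighted EP with weights $F$ and $E$; (xii) $T$ is both weighted EP with weights $E$ and $E$ and weighted EP with weights $F$ and $F$; (xiii) $T^k$ is weighted EP with weights $E$ and $F$, for some integer $k\geq 1$; (xiv) $T^{\sharp}$ is weighted EP with weights $E$ and $F$; (xv) $TT^{\sharp}=TT^\dagger_{E,E}=TT^\dagger_{F,F}$ (or, alternatively, $TT^{\sharp}=T^\dagger_{E,E}T=T^\dagger_{F,F}T$);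 (xvi) $TT^{\sharp}=TT^\dagger_{E,F}=TT^\dagger_{F,E}$ (or, alternatively, $TT^{\sharp}=T^\dagger_{F,E}T=T^\dagger_{E,F}T$).
   Context: For a complex Banach space $X$, $L(X)$ is the Banach algebra of bounded linear operators on $X$ with the operator norm; $R(T)$ and $N(T)$ are the range and null space of $T\in L(X)$. Let $A$ be a complex unital Banach algebra (here $A=L(X)$). An element $h\in A$ is hermitian if $\|\exp(ith)\|=1$ for all $t\in\mathbb R$ (for $t=0$ this entails $\|1\|=1$); $H(A)$ is the set of hermitian elements of $A$. An element $c\in A$ is positive if $V(c)=\{\varphi(c):\varphi\in A^*,\ \|\varphi\|\le 1,\ \varphi(1)=1\}\subset[0,\infty)$; equivalently, $c$ is hermitian and $\sigma(c)\subset[0,\infty)$. A positive element $c$ has a unique positive square root, denoted $c^{1/2}$. For $u\in A$ invertible and positive, $u^{-1/2}=(u^{1/2})^{-1}$, and $A^u$ denotes the Banach algebra $A$ endowed with the norm $\|x\|_u=\|u^{1/2}xu^{-1/2}\|$. An element $b\in A$ is a normalized generalized inverse of $a\in A$ if $aba=a$ and $bab=b$. Given $e,f\in A$ invertible and positive, $a$ is weighted Moore-Penrose invertible with weights $e$ and $f$ if there is a normalized generalized inverse $b$ of $a$ with $ab\in H(A^e)$ and $ba\in H(A^f)$; such $b$ is unique when it exists and is denoted $a^{\dag}_{e,f}$ (also written $a^{\dagger}_{e,f}$). The element $a$ is weighted EP with weights $e$ and $f$ if $a^{\dag}_{e,f}$ exists and commutes with $a$. The group inverse of $a$, denoted $a^{\sharp}$,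 is the (unique, when it exists) $b\in A$ with $aba=a$, $bab=b$, $ab=ba$. Conventions: a statement involving a weighted Moore-Penrose inverse with a pair of weights other than $(E,F)$ includes the assertion that this inverse exists. In (xv) and (xvi), each of the two alternative forms is equivalent to the other statements. *)

theory Defs
  imports "HOL-Analysis.Analysis" "HOL-Library.Nonpos_Ints"
begin

class complex_vector = real_vector +
  fixes scaleC :: "complex \<Rightarrow> 'a \<Rightarrow> 'a" (infixr "*\<^sub>C" 75)
  assumes scaleC_add_right: "c *\<^sub>C (x + y) = c *\<^sub>C x + c *\<^sub>C y"
    and scaleC_add_left: "(c + d) *\<^sub>C x = c *\<^sub>C x + d *\<^sub>C x"
    and scaleC_scaleC: "c *\<^sub>C d *\<^sub>C x = (c * d) *\<^sub>C x"
    and scaleR_scaleC: "r *\<^sub>R x = complex_of_real r *\<^sub>C x"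

class complex_normed_vector = complex_vector + real_normed_vector +
  assumes norm_scaleC: "norm (c *\<^sub>C x) = cmod c * norm x"

class complex_banach = complex_normed_vector + banach

text \<open>Unlike in \<^class>\<open>real_normed_algebra_1\<close>, neither \<open>0 \<noteq> 1\<close> nor \<open>norm 1 = 1\<close> is required,
  so that the operators on the zero space are included.\<close>

class complex_banach_algebra = complex_banach + real_normed_algebra + monoid_mult +
  assumes mult_scaleC_left: "(c *\<^sub>C x) * y = c *\<^sub>C (x * y)"
    and mult_scaleC_right: "x * (c *\<^sub>C y) = c *\<^sub>C (x * y)"

text \<open>\<open>L(X)\<close> is the type of complex-linear elements of the library's type of bounded
  real-linear maps, with the norm (the operator norm) inherited from there.\<close>

typedef (overloaded) 'a operator =
  "{f :: 'a::complex_normed_vector \<Rightarrow>\<^sub>L 'a. \<forall>c x. blinfun_apply f (c *\<^sub>C x) = c *\<^sub>C blinfun_apply f x}"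
  morphisms blinfun_of_operator Operator
proof -
  have "id_blinfun \<in> {f :: 'a \<Rightarrow>\<^sub>L 'a. \<forall>c x. blinfun_apply f (c *\<^sub>C x) = c *\<^sub>C blinfun_apply f x}"
    by simp
  then show ?thesis by blast
qed

setup_lifting type_definition_operator

definition op_apply :: "'a::complex_normed_vector operator \<Rightarrow> 'a \<Rightarrow> 'a" where
  "op_apply T = blinfun_apply (blinfun_of_operator T)"

lemma scaleC_zero_right: "c *\<^sub>C (0 :: 'a::complex_vector) = 0"
  using scaleC_add_right[of c 0 "0::'a"] by simp

lemma scaleC_minus_right: "c *\<^sub>C (- x :: 'a::complex_vector) = - (c *\<^sub>C x)"
  using scaleC_add_right[of c x "- x"] by (simp add: scaleC_zero_right eq_neg_iff_add_eq_0 add.commute)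

lemma scaleC_diff_right: "c *\<^sub>C (x - y :: 'a::complex_vector) = c *\<^sub>C x - c *\<^sub>C y"
  using scaleC_add_right[of c x "- y"] by (simp add: scaleC_minus_right)

lemma scaleC_scaleR_commute: "c *\<^sub>C r *\<^sub>R (x :: 'a::complex_vector) = r *\<^sub>R c *\<^sub>C x"
  by (simp add: scaleR_scaleC scaleC_scaleC mult.commute)

lemma bounded_linear_scaleC: "bounded_linear (\<lambda>x :: 'a::complex_normed_vector. c *\<^sub>C x)"
  by (rule bounded_linear_intro[of _ "cmod c"])
    (simp_all add: scaleC_add_right scaleC_scaleR_commute norm_scaleC mult.commute)

lift_definition scaleC_blinfun :: "complex \<Rightarrow> ('a::complex_normed_vector \<Rightarrow>\<^sub>L 'a)" is
  "\<lambda>c x. c *\<^sub>C x"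
  by (rule bounded_linear_scaleC)

instantiation operator :: (complex_normed_vector) "{complex_normed_vector, real_normed_algebra, monoid_mult}"
begin

lift_definition zero_operator :: "'a operator" is "0"
  by (simp add: scaleC_zero_right)

lift_definition one_operator :: "'a operator" is "id_blinfun"
  by simp

lift_definition plus_operator :: "'a operator \<Rightarrow> 'a operator \<Rightarrow> 'a operator" is "(+)"
  by (simp add: blinfun.add_left scaleC_add_right)

lift_definition minus_operator :: "'a operator \<Rightarrow> 'a operator \<Rightarrow> 'a operator" is "(-)"
  by (simp add: blinfun.diff_left scaleC_diff_right)

lift_definition uminus_operator :: "'a operator \<Rightarrow> 'a operator" is "uminus"
  by (simp add: blinfun.minus_left scaleC_minus_right)

lift_definition scaleR_operator :: "real \<Rightarrow> 'a operator \<Rightarrow> 'a operator" is "scaleR"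
  by (simp add: blinfun.scaleR_left scaleC_scaleR_commute)

lift_definition scaleC_operator :: "complex \<Rightarrow> 'a operator \<Rightarrow> 'a operator" is
  "\<lambda>c f. scaleC_blinfun c o\<^sub>L f"
  by (simp add: scaleC_blinfun.rep_eq scaleC_scaleC mult.commute)

lift_definition times_operator :: "'a operator \<Rightarrow> 'a operator \<Rightarrow> 'a operator" is "(o\<^sub>L)"
  by simp

lift_definition norm_operator :: "'a operator \<Rightarrow> real" is "norm" .

definition dist_operator :: "'a operator \<Rightarrow> 'a operator \<Rightarrow> real" where
  "dist_operator a b = norm (a - b)"

definition sgn_operator :: "'a operator \<Rightarrow> 'a operator" where
  "sgn_operator a = scaleR (inverse (norm a)) a"

definition [code del]:
  "(uniformity :: ('a operator \<times> 'a operator) filter) = (INF e\<in>{0<..}. principal {(x, y). dist x y < e})"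

definition open_operator :: "'a operator set \<Rightarrow> bool" where
  [code del]: "open_operator S = (\<forall>x\<in>S. \<forall>\<^sub>F (x', y) in uniformity. x' = x \<longrightarrow> y \<in> S)"

instance
proof
  fix a b c :: "'a operator" and r s :: real and u v :: complex
  show "dist a b = norm (a - b)" by (rule dist_operator_def)
  show "sgn a = inverse (norm a) *\<^sub>R a" by (rule sgn_operator_def)
  show "(uniformity :: ('a operator \<times> 'a operator) filter) = (INF e\<in>{0<..}. principal {(x, y). dist x y < e})"
    by (rule uniformity_operator_def)
  show "open S = (\<forall>x\<in>S. \<forall>\<^sub>F (x', y) in uniformity. x' = x \<longrightarrow> y \<in> S)" for S :: "'a operator set"
    by (rule open_operator_def)
  show "a + b + c = a + (b + c)" by transfer (simp add: add.assoc)
  show "a + b = b + a" by transfer (simp add: add.commute)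
  show "0 + a = a" by transfer simp
  show "- a + a = 0" by transfer simp
  show "a - b = a + - b" by transfer simp
  show "r *\<^sub>R (a + b) = r *\<^sub>R a + r *\<^sub>R b" by transfer (simp add: scaleR_add_right)
  show "(r + s) *\<^sub>R a = r *\<^sub>R a + s *\<^sub>R a" by transfer (simp add: scaleR_add_left)
  show "r *\<^sub>R s *\<^sub>R a = (r * s) *\<^sub>R a" by transfer simp
  show "1 *\<^sub>R a = a" by transfer simp
  show "norm a = 0 \<longleftrightarrow> a = 0" by transfer simp
  show "norm (a + b) \<le> norm a + norm b" by transfer (rule norm_triangle_ineq)
  show "norm (r *\<^sub>R a) = \<bar>r\<bar> * norm a" by transfer simp
  show "u *\<^sub>C (a + b) = u *\<^sub>C a + u *\<^sub>C b"
    by transfer (auto intro!: blinfun_eqI simp: scaleC_blinfun.rep_eq blinfun.add_left scaleC_add_right)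
  show "(u + v) *\<^sub>C a = u *\<^sub>C a + v *\<^sub>C a"
    by transfer (auto intro!: blinfun_eqI simp: scaleC_blinfun.rep_eq blinfun.add_left scaleC_add_left)
  show "u *\<^sub>C v *\<^sub>C a = (u * v) *\<^sub>C a"
    by transfer (auto intro!: blinfun_eqI simp: scaleC_blinfun.rep_eq scaleC_scaleC)
  show "r *\<^sub>R a = complex_of_real r *\<^sub>C a"
    by transfer (auto intro!: blinfun_eqI simp: scaleC_blinfun.rep_eq blinfun.scaleR_left scaleR_scaleC)
  show "norm (u *\<^sub>C a) = cmod u * norm a"
  proof transfer
    fix u :: complex and f :: "'a \<Rightarrow>\<^sub>L 'a"
    have *: "norm (blinfun_apply (scaleC_blinfun u o\<^sub>L f) x) = norm (blinfun_apply (cmod u *\<^sub>R f) x)" for x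
      by (simp add: scaleC_blinfun.rep_eq norm_scaleC blinfun.scaleR_left)
    have "norm (scaleC_blinfun u o\<^sub>L f) = norm (cmod u *\<^sub>R f)"
      unfolding norm_blinfun.rep_eq onorm_def * ..
    then show "norm (scaleC_blinfun u o\<^sub>L f) = cmod u * norm f" by simp
  qed
  show "a * b * c = a * (b * c)" by transfer (auto intro!: blinfun_eqI)
  show "(a + b) * c = a * c + b * c" by transfer (auto intro!: blinfun_eqI simp: blinfun.add_left)
  show "a * (b + c) = a * b + a * c"
    by transfer (auto intro!: blinfun_eqI simp: blinfun.add_left blinfun.add_right)
  show "1 * a = a" by transfer (auto intro!: blinfun_eqI)
  show "a * 1 = a" by transfer (auto intro!: blinfun_eqI)
  show "r *\<^sub>R a * b = r *\<^sub>R (a * b)" by transfer (auto intro!: blinfun_eqI simp: blinfun.scaleR_left)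
  show "a * r *\<^sub>R b = r *\<^sub>R (a * b)"
    by transfer (auto intro!: blinfun_eqI simp: blinfun.scaleR_left blinfun.scaleR_right)
  show "norm (a * b) \<le> norm a * norm b" by transfer (rule norm_blinfun_compose)
qed

end

instance operator :: (complex_banach) complex_banach_algebra
proof
  fix X :: "nat \<Rightarrow> 'a operator"
  assume X: "Cauchy X"
  let ?Y = "\<lambda>n. blinfun_of_operator (X n)"
  have d: "dist (blinfun_of_operator S) (blinfun_of_operator T) = dist S T" for S T :: "'a operator"
    by (simp add: dist_norm norm_operator.rep_eq minus_operator.rep_eq)
  have "Cauchy ?Y" using X by (simp add: Cauchy_def d)
  then obtain L where L: "?Y \<longlonglongrightarrow> L" by (auto simp: Cauchy_convergent_iff convergent_def)
  have ap: "(\<lambda>n. blinfun_apply (?Y n) x) \<longlonglongrightarrow> blinfun_apply L x" for x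
    by (intro tendsto_intros L)
  have "blinfun_apply L (c *\<^sub>C x) = c *\<^sub>C blinfun_apply L x" for c x
  proof (rule LIMSEQ_unique[OF ap])
    show "(\<lambda>n. blinfun_apply (?Y n) (c *\<^sub>C x)) \<longlonglongrightarrow> c *\<^sub>C blinfun_apply L x"
    proof -
      have "blinfun_apply (?Y n) (c *\<^sub>C x) = c *\<^sub>C blinfun_apply (?Y n) x" for n
        using blinfun_of_operator[of "X n"] by simp
      then show ?thesis by (simp add: bounded_linear.tendsto[OF bounded_linear_scaleC ap])
    qed
  qed
  then have "blinfun_of_operator (Operator L) = L" by (simp add: Operator_inverse)
  then have "X \<longlonglongrightarrow> Operator L" using L by (simp add: lim_sequentially d[symmetric])
  then show "convergent X" by (auto simp: convergent_def)
next
  fix a b :: "'a operator" and c :: complex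
  show "c *\<^sub>C a * b = c *\<^sub>C (a * b)" by transfer (auto intro!: blinfun_eqI)
  show "a * c *\<^sub>C b = c *\<^sub>C (a * b)"
    by transfer (auto intro!: blinfun_eqI simp: scaleC_blinfun.rep_eq)
qed

definition op_range :: "'a::complex_normed_vector operator \<Rightarrow> 'a set" where
  "op_range T = range (op_apply T)"

definition op_null :: "'a::complex_normed_vector operator \<Rightarrow> 'a set" where
  "op_null T = {x. op_apply T x = 0}"

text \<open>This is the defining series of the library function \<^const>\<open>exp\<close>, which is only available
  under the hypothesis \<open>norm 1 = 1\<close> of \<^class>\<open>real_normed_algebra_1\<close>.\<close>

definition exp_elem :: "'a::complex_banach_algebra \<Rightarrow> 'a" where
  "exp_elem a = (\<Sum>n. a ^ n /\<^sub>R fact n)"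

definition alg_invertible :: "'a::complex_banach_algebra \<Rightarrow> bool" where
  "alg_invertible a \<longleftrightarrow> (\<exists>b. a * b = 1 \<and> b * a = 1)"

definition alg_inverse :: "'a::complex_banach_algebra \<Rightarrow> 'a" where
  "alg_inverse a = (THE b. a * b = 1 \<and> b * a = 1)"

text \<open>The bound \<open>cmod (\<phi> x) \<le> norm x\<close> for all \<open>x\<close> says that \<open>\<phi>\<close> lies in the dual space and
  \<open>\<parallel>\<phi>\<parallel> \<le> 1\<close>.\<close>

definition num_range :: "'a::complex_banach_algebra \<Rightarrow> complex set" where
  "num_range a = {\<phi> a | \<phi>.
     (\<forall>x y. \<phi> (x + y) = \<phi> x + \<phi> y) \<and> (\<forall>c x. \<phi> (c *\<^sub>C x) = c * \<phi> x) \<and>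
     (\<forall>x. cmod (\<phi> x) \<le> norm x) \<and> \<phi> 1 = 1}"

definition positive_elem :: "'a::complex_banach_algebra \<Rightarrow> bool" where
  "positive_elem a \<longleftrightarrow> num_range a \<subseteq> \<real>\<^sub>\<ge>\<^sub>0"

definition is_pos_sqrt :: "'a::complex_banach_algebra \<Rightarrow> 'a \<Rightarrow> bool" where
  "is_pos_sqrt u s \<longleftrightarrow> positive_elem s \<and> s * s = u"

definition pos_sqrt :: "'a::complex_banach_algebra \<Rightarrow> 'a" where
  "pos_sqrt u = (THE s. is_pos_sqrt u s)"

definition weighted_norm :: "'a::complex_banach_algebra \<Rightarrow> 'a \<Rightarrow> real" where
  "weighted_norm u x = norm (pos_sqrt u * x * alg_inverse (pos_sqrt u))"

text \<open>Membership in \<open>H(A\<^sup>u)\<close>. The norm of \<open>A\<^sup>u\<close> is equivalent to that of \<open>A\<close>, so the exponential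
  computed in \<open>A\<^sup>u\<close> is the one computed in \<open>A\<close>. The first conjunct says that \<open>pos_sqrt u\<close> really
  denotes the positive square root of \<open>u\<close>: where the definite description has no referent there is
  no algebra \<open>A\<^sup>u\<close>, and an arbitrary value must not define one.\<close>

definition weighted_hermitian :: "'a::complex_banach_algebra \<Rightarrow> 'a \<Rightarrow> bool" where
  "weighted_hermitian u h \<longleftrightarrow> is_pos_sqrt u (pos_sqrt u) \<and>
     (\<forall>t::real. weighted_norm u (exp_elem ((\<i> * complex_of_real t) *\<^sub>C h)) = 1)"

definition is_mp_inv :: "'a::complex_banach_algebra \<Rightarrow> 'a \<Rightarrow> 'a \<Rightarrow> 'a \<Rightarrow> bool" where
  "is_mp_inv e f a b \<longleftrightarrow> a * b * a = a \<and> b * a * b = b \<and>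
     weighted_hermitian e (a * b) \<and> weighted_hermitian f (b * a)"

definition mp_invertible :: "'a::complex_banach_algebra \<Rightarrow> 'a \<Rightarrow> 'a \<Rightarrow> bool" where
  "mp_invertible e f a \<longleftrightarrow> (\<exists>b. is_mp_inv e f a b)"

definition mp_inv :: "'a::complex_banach_algebra \<Rightarrow> 'a \<Rightarrow> 'a \<Rightarrow> 'a" where
  "mp_inv e f a = (THE b. is_mp_inv e f a b)"

definition weighted_EP :: "'a::complex_banach_algebra \<Rightarrow> 'a \<Rightarrow> 'a \<Rightarrow> bool" where
  "weighted_EP e f a \<longleftrightarrow> mp_invertible e f a \<and> a * mp_inv e f a = mp_inv e f a * a"

definition is_group_inv :: "'a::complex_banach_algebra \<Rightarrow> 'a \<Rightarrow> bool" where
  "is_group_inv a b \<longleftrightarrow> a * b * a = a \<and> b * a * b = b \<and> a * b = b * a"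

definition group_invertible :: "'a::complex_banach_algebra \<Rightarrow> bool" where
  "group_invertible a \<longleftrightarrow> (\<exists>b. is_group_inv a b)"

definition group_inv :: "'a::complex_banach_algebra \<Rightarrow> 'a" where
  "group_inv a = (THE b. is_group_inv a b)"

end

theory Submission
  imports Defs
begin

text \<open>
  Everything rests on a rigidity of hermitian idempotents. If \<open>h\<close> is idempotent, then
  \<open>exp (i\<pi>h) = 1 - 2h\<close>, so a hermitian idempotent gives a reflection of norm one. If two hermitian
  idempotents \<open>p\<close>, \<open>q\<close> have the same range, or the same kernel, then \<open>(p - q)\<^sup>2 = 0\<close> and the product
  of their reflections is \<open>1 \<mp> 2(p - q)\<close>, whose \<open>n\<close>-th power \<open>1 \<mp> 2n(p - q)\<close> stays in the unit ball.
  Hence \<open>p = q\<close> (\<open>weighted_hermitian_same_range\<close>, \<open>weighted_hermitian_same_kernel\<close>). Since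
  \<open>A\<^sup>u\<close> is a conjugate of \<open>A\<close>, this works for every invertible weight \<open>u\<close>, and it makes weighted
  Moore-Penrose inverses unique.

  If \<open>a\<close> has the group inverse \<open>g\<close>, then \<open>a\<close> is weighted EP with weights \<open>e\<close> and \<open>f\<close> exactly if
  the single idempotent \<open>ag\<close> is hermitian in both \<open>A\<^sup>e\<close> and \<open>A\<^sup>f\<close> (\<open>weighted_EP_iff\<close>). This condition
  is symmetric in the weights and is unchanged when \<open>a\<close> is replaced by a power or by \<open>g\<close>, which
  have the same idempotent; and \<open>T T\<^sup>\<sharp> = T T\<^sup>\<dagger>\<close> with various weights just asserts hermiticity of
  this idempotent. All statements that involve other weights, powers or the group inverse follow.

  The remaining statements compare the idempotents \<open>p = TT\<^sup>\<dagger>\<close> and \<open>q = T\<^sup>\<dagger>T\<close>, and \<open>T\<close> is weighted EP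
  if and only if \<open>p = q\<close>. A range inclusion says that one of \<open>p\<close>, \<open>q\<close> acts on the left of the
  other as the identity, a kernel inclusion says the same about the right. Two of the four possible
  pairs of inclusions yield \<open>p = q\<close> at once; for the other two, the spectral idempotent \<open>TT\<^sup>\<sharp>\<close>, with the
  range of \<open>p\<close> and the kernel of \<open>q\<close>, has to be brought in (\<open>commute_of_absorb_left\<close>,
  \<open>commute_of_absorb_right\<close>).
\<close>

section \<open>Reflections in hermitian idempotents\<close>

lemma scaleC_one: "1 *\<^sub>C (x :: 'a::complex_vector) = x"
  using scaleR_scaleC[of 1 x] by simp

lemma bounded_linear_scaleC_left:
  "bounded_linear (\<lambda>c. c *\<^sub>C (x :: 'a::complex_normed_vector))"
proof (rule bounded_linear_intro[of _ "norm x"])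
  show "(r *\<^sub>R c) *\<^sub>C x = r *\<^sub>R c *\<^sub>C x" for r c
    by (simp add: scaleR_scaleC scaleC_scaleC scaleR_conv_of_real)
qed (simp_all add: scaleC_add_left norm_scaleC)

lemma power_scaleC_idempotent:
  fixes p :: "'a::complex_banach_algebra"
  assumes "p * p = p"
  shows "(c *\<^sub>C p) ^ Suc n = c ^ Suc n *\<^sub>C p"
proof (induction n)
  case (Suc n)
  then show ?case
    using assms
    by (simp add: power_Suc[of "c *\<^sub>C p" "Suc n"] power_Suc2[of c "Suc n"] mult_scaleC_left
        mult_scaleC_right scaleC_scaleC del: power_Suc)
qed simp

lemma exp_elem_idempotent:
  fixes p :: "'a::complex_banach_algebra"
  assumes p: "p * p = p"
  shows "exp_elem (c *\<^sub>C p) = exp c *\<^sub>C p + (1 - p)"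
proof -
  have "(c *\<^sub>C p) ^ n /\<^sub>R fact n = (c ^ n /\<^sub>R fact n) *\<^sub>C p + (if n = 0 then 1 - p else 0)" for n
  proof (cases n)
    case 0
    then show ?thesis by (simp add: scaleC_one)
  next
    case (Suc m)
    have "(c ^ n /\<^sub>R fact n) *\<^sub>C p = (c ^ n *\<^sub>C p) /\<^sub>R fact n"
      by (simp add: scaleR_scaleC scaleC_scaleC scaleR_conv_of_real)
    then show ?thesis
      using Suc power_scaleC_idempotent[OF p, of c m] by simp
  qed
  moreover have "(\<lambda>n. (c ^ n /\<^sub>R fact n) *\<^sub>C p) sums (exp c *\<^sub>C p)"
    by (rule bounded_linear.sums[OF bounded_linear_scaleC_left exp_converges])
  moreover have "(\<lambda>n. if n = 0 then 1 - p else 0) sums (1 - p)"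
    using sums_single[of 0 "\<lambda>_. 1 - p"] by simp
  ultimately have "(\<lambda>n. (c *\<^sub>C p) ^ n /\<^sub>R fact n) sums (exp c *\<^sub>C p + (1 - p))"
    by (simp add: sums_add)
  then show ?thesis
    by (simp add: exp_elem_def sums_iff)
qed

lemma exp_elem_idempotent_pi:
  fixes p :: "'a::complex_banach_algebra"
  assumes "p * p = p"
  shows "exp_elem ((\<i> * complex_of_real pi) *\<^sub>C p) = 1 - 2 *\<^sub>R p"
proof -
  have "(- 1) *\<^sub>C p = - p"
    using scaleR_scaleC[of "- 1" p] by simp
  moreover have "exp (\<i> * complex_of_real pi) = - 1"
    by (rule exp_pi_i')
  ultimately show ?thesis
    by (simp only: exp_elem_idempotent[OF assms]) (simp add: scaleR_2)
qed

lemma left_inverse_eq_right_inverse: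
  fixes a :: "'a::monoid_mult"
  assumes "b * a = 1" "a * c = 1"
  shows "b = c"
proof -
  have "b = b * (a * c)" by (simp add: assms)
  also have "\<dots> = c" by (simp add: mult.assoc[symmetric] assms(1))
  finally show ?thesis .
qed

lemma alg_inverse_eqI:
  fixes a :: "'a::complex_banach_algebra"
  assumes "a * b = 1" "b * a = 1"
  shows "alg_inverse a = b"
  unfolding alg_inverse_def
proof (rule the_equality)
  fix c assume "a * c = 1 \<and> c * a = 1"
  then show "c = b"
    using left_inverse_eq_right_inverse assms(1) by blast
qed (use assms in simp)

lemma pos_sqrt_inverse:
  fixes u :: "'a::complex_banach_algebra"
  assumes "alg_invertible u" and "is_pos_sqrt u (pos_sqrt u)"
  shows "pos_sqrt u * alg_inverse (pos_sqrt u) = 1"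
    and "alg_inverse (pos_sqrt u) * pos_sqrt u = 1"
proof -
  let ?s = "pos_sqrt u"
  have s: "?s * ?s = u"
    using assms(2) by (simp add: is_pos_sqrt_def)
  obtain v where v: "u * v = 1" "v * u = 1"
    using assms(1) by (auto simp: alg_invertible_def)
  have r: "?s * (?s * v) = 1"
    using s v by (simp add: mult.assoc[symmetric])
  have l: "(v * ?s) * ?s = 1"
    using s v by (simp add: mult.assoc)
  have "v * ?s = ?s * v"
    using l r by (rule left_inverse_eq_right_inverse)
  then have "alg_inverse ?s = ?s * v"
    using alg_inverse_eqI[OF r] l by simp
  then show "?s * alg_inverse ?s = 1" "alg_inverse ?s * ?s = 1"
    using l r \<open>v * ?s = ?s * v\<close> by simp_all
qed

lemma weighted_hermitian_reflection:
  fixes p :: "'a::complex_banach_algebra"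
  assumes "weighted_hermitian u p" and "p * p = p"
  shows "weighted_norm u (1 - 2 *\<^sub>R p) = 1"
proof -
  have "weighted_norm u (exp_elem ((\<i> * complex_of_real pi) *\<^sub>C p)) = 1"
    using assms(1) unfolding weighted_hermitian_def by blast
  then show ?thesis
    by (simp only: exp_elem_idempotent_pi[OF assms(2)])
qed

lemma weighted_norm_mult_le:
  fixes u :: "'a::complex_banach_algebra"
  assumes "alg_invertible u" and "is_pos_sqrt u (pos_sqrt u)"
  shows "weighted_norm u (x * y) \<le> weighted_norm u x * weighted_norm u y"
proof -
  let ?s = "pos_sqrt u" and ?r = "alg_inverse (pos_sqrt u)"
  have "?s * (x * y) * ?r = ?s * x * (?r * ?s) * y * ?r"
    by (simp add: pos_sqrt_inverse[OF assms] mult.assoc)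
  also have "\<dots> = (?s * x * ?r) * (?s * y * ?r)"
    by (simp only: mult.assoc)
  finally show ?thesis
    unfolding weighted_norm_def by (simp add: norm_mult_ineq)
qed

lemma weighted_norm_eq_0D:
  fixes u :: "'a::complex_banach_algebra"
  assumes "alg_invertible u" and "is_pos_sqrt u (pos_sqrt u)" and "weighted_norm u x = 0"
  shows "x = 0"
proof -
  let ?s = "pos_sqrt u" and ?r = "alg_inverse (pos_sqrt u)"
  have "x = (?r * ?s) * x * (?r * ?s)"
    by (simp add: pos_sqrt_inverse[OF assms(1,2)])
  also have "\<dots> = ?r * (?s * x * ?r) * ?s"
    by (simp only: mult.assoc)
  also have "\<dots> = 0"
    using assms(3) by (simp add: weighted_norm_def)
  finally show ?thesis .
qed

text \<open>The powers of \<open>1 - 2h\<close> grow linearly when \<open>h\<^sup>2 = 0\<close>, which is incompatible with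
  \<open>1 - 2h\<close> being a contraction.\<close>

lemma square_zero_contraction:
  fixes h :: "'a::complex_banach_algebra"
  assumes u: "alg_invertible u" "is_pos_sqrt u (pos_sqrt u)"
    and h: "h * h = 0" and le: "weighted_norm u (1 - 2 *\<^sub>R h) \<le> 1"
  shows "h = 0"
proof -
  let ?s = "pos_sqrt u" and ?r = "alg_inverse (pos_sqrt u)"
  have pow: "weighted_norm u (1 - (2 * real (Suc n)) *\<^sub>R h) \<le> 1" for n
  proof (induction n)
    case 0
    then show ?case using le by simp
  next
    case (Suc n)
    have "1 - (2 * real (Suc (Suc n))) *\<^sub>R h = (1 - 2 *\<^sub>R h) * (1 - (2 * real (Suc n)) *\<^sub>R h)"
      using h by (simp add: algebra_simps flip: scaleR_add_left)
    then have "weighted_norm u (1 - (2 * real (Suc (Suc n))) *\<^sub>R h)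
        \<le> weighted_norm u (1 - 2 *\<^sub>R h) * weighted_norm u (1 - (2 * real (Suc n)) *\<^sub>R h)"
      using weighted_norm_mult_le[OF u] by metis
    also have "\<dots> \<le> 1"
      using Suc le by (simp add: mult_le_one weighted_norm_def)
    finally show ?case .
  qed
  have bound: "real n * weighted_norm u h \<le> 1 + weighted_norm u 1" for n
  proof -
    have "?s * ((2 * real (Suc n)) *\<^sub>R h) * ?r = ?s * 1 * ?r - ?s * (1 - (2 * real (Suc n)) *\<^sub>R h) * ?r"
      by (simp add: right_diff_distrib left_diff_distrib)
    then have "norm (?s * ((2 * real (Suc n)) *\<^sub>R h) * ?r) \<le> 1 + weighted_norm u 1"
      using norm_triangle_ineq4[of "?s * 1 * ?r" "?s * (1 - (2 * real (Suc n)) *\<^sub>R h) * ?r"] pow[of n]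
      by (simp add: weighted_norm_def)
    then have "(2 * real (Suc n)) * weighted_norm u h \<le> 1 + weighted_norm u 1"
      by (simp add: weighted_norm_def)
    moreover have "real n * weighted_norm u h \<le> (2 * real (Suc n)) * weighted_norm u h"
      by (intro mult_right_mono) (simp_all add: weighted_norm_def)
    ultimately show ?thesis by linarith
  qed
  have "weighted_norm u h = 0"
  proof (rule ccontr)
    assume "weighted_norm u h \<noteq> 0"
    then have "0 < weighted_norm u h" by (simp add: weighted_norm_def)
    then obtain n where "1 + weighted_norm u 1 < real n * weighted_norm u h"
      using reals_Archimedean3 by blast
    then show False using bound[of n] by linarith
  qed
  then show ?thesis by (rule weighted_norm_eq_0D[OF u])
qed

lemma contractive_reflection_product:
  fixes p q :: "'a::complex_banach_algebra"
  assumes u: "alg_invertible u"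
    and p: "weighted_hermitian u p" "p * p = p" and q: "weighted_hermitian u q" "q * q = q"
    and h: "h * h = 0" and prod: "(1 - 2 *\<^sub>R p) * (1 - 2 *\<^sub>R q) = 1 - 2 *\<^sub>R h"
  shows "h = 0"
proof (rule square_zero_contraction[OF u _ h])
  show s: "is_pos_sqrt u (pos_sqrt u)"
    using p(1) by (simp add: weighted_hermitian_def)
  show "weighted_norm u (1 - 2 *\<^sub>R h) \<le> 1"
    using weighted_norm_mult_le[OF u s, of "1 - 2 *\<^sub>R p" "1 - 2 *\<^sub>R q"]
    by (simp add: prod weighted_hermitian_reflection p q)
qed

lemma weighted_hermitian_same_range:
  fixes p q :: "'a::complex_banach_algebra"
  assumes "alg_invertible u" and "weighted_hermitian u p" "weighted_hermitian u q"
    and "p * q = q" "q * p = p"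
  shows "p = q"
proof -
  have "p * p = p" "q * q = q"
    using assms(4,5) by (metis mult.assoc)+
  moreover have "(p - q) * (p - q) = 0" "(1 - 2 *\<^sub>R p) * (1 - 2 *\<^sub>R q) = 1 - 2 *\<^sub>R (p - q)"
    using assms(4,5) \<open>p * p = p\<close> \<open>q * q = q\<close> by (simp_all add: algebra_simps scaleR_2)
  ultimately have "p - q = 0"
    using contractive_reflection_product assms(1-3) by blast
  then show ?thesis by simp
qed

lemma weighted_hermitian_same_kernel:
  fixes p q :: "'a::complex_banach_algebra"
  assumes "alg_invertible u" and "weighted_hermitian u p" "weighted_hermitian u q"
    and "p * q = p" "q * p = q"
  shows "p = q"
proof -
  have "p * p = p" "q * q = q"
    using assms(4,5) by (metis mult.assoc)+
  moreover have "(q - p) * (q - p) = 0" "(1 - 2 *\<^sub>R p) * (1 - 2 *\<^sub>R q) = 1 - 2 *\<^sub>R (q - p)"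
    using assms(4,5) \<open>p * p = p\<close> \<open>q * q = q\<close> by (simp_all add: algebra_simps scaleR_2)
  ultimately have "q - p = 0"
    using contractive_reflection_product assms(1-3) by blast
  then show ?thesis by simp
qed

section \<open>Uniqueness of the generalized inverses\<close>

lemma is_mp_inv_unique:
  fixes a :: "'a::complex_banach_algebra"
  assumes "alg_invertible e" "alg_invertible f" and b: "is_mp_inv e f a b" and c: "is_mp_inv e f a c"
  shows "b = c"
proof -
  note b = b[unfolded is_mp_inv_def] and c = c[unfolded is_mp_inv_def]
  have ab: "a * b = a * c"
  proof (rule weighted_hermitian_same_range[OF assms(1)])
    show "a * b * (a * c) = a * c" "a * c * (a * b) = a * b"
      using b c by (simp_all add: mult.assoc[symmetric])
  qed (use b c in simp_all)
  have ba: "b * a = c * a"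
  proof (rule weighted_hermitian_same_kernel[OF assms(2)])
    show "b * a * (c * a) = b * a" "c * a * (b * a) = c * a"
      using b c by (simp_all add: mult.assoc)
  qed (use b c in simp_all)
  have "b = b * (a * b)" using b by (simp add: mult.assoc)
  also have "\<dots> = (b * a) * c" by (simp only: ab mult.assoc)
  also have "\<dots> = c" using c by (simp add: ba)
  finally show ?thesis .
qed

lemma mp_inv_eqI:
  fixes a :: "'a::complex_banach_algebra"
  assumes "alg_invertible e" "alg_invertible f" and "is_mp_inv e f a b"
  shows "mp_inv e f a = b"
  unfolding mp_inv_def using assms is_mp_inv_unique by blast

lemma is_mp_inv_mp_inv:
  fixes a :: "'a::complex_banach_algebra"
  assumes "alg_invertible e" "alg_invertible f" and "mp_invertible e f a"
  shows "is_mp_inv e f a (mp_inv e f a)"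
  using assms mp_inv_eqI unfolding mp_invertible_def by metis

lemma is_group_inv_unique:
  fixes a :: "'a::complex_banach_algebra"
  assumes "is_group_inv a b" and "is_group_inv a c"
  shows "b = c"
proof -
  note b = assms(1)[unfolded is_group_inv_def] and c = assms(2)[unfolded is_group_inv_def]
  have "a * b = a * c"
    using b c by (metis mult.assoc)
  then show ?thesis
    using b c by (metis mult.assoc)
qed

lemma group_inv_eqI:
  fixes a :: "'a::complex_banach_algebra"
  assumes "is_group_inv a b"
  shows "group_inv a = b"
  unfolding group_inv_def using assms is_group_inv_unique by blast

lemma is_group_inv_power:
  fixes a :: "'a::complex_banach_algebra"
  assumes "is_group_inv a g"
  shows "is_group_inv (a ^ Suc n) (g ^ Suc n)" and "a ^ Suc n * g ^ Suc n = a * g"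
proof -
  have g: "a * g * a = a" "g * a * g = g" "a * g = g * a"
    using assms by (auto simp only: is_group_inv_def)
  have idem: "a ^ Suc n * g ^ Suc n = a * g" for n
  proof (induction n)
    case (Suc n)
    have "a ^ Suc (Suc n) * g ^ Suc (Suc n) = a * (a ^ Suc n * g ^ Suc n) * g"
      by (simp add: power_Suc[of a "Suc n"] power_Suc2[of g "Suc n"] mult.assoc
          del: power_Suc)
    also have "\<dots> = a * (a * g) * g"
      by (simp only: Suc)
    also have "\<dots> = a * g"
      using g by (metis mult.assoc)
    finally show ?case .
  qed simp
  show "a ^ Suc n * g ^ Suc n = a * g"
    by (rule idem)
  have comm: "a ^ Suc n * g ^ Suc n = g ^ Suc n * a ^ Suc n"
    using g(3) by (metis power_commuting_commutes)
  have "a * g * a ^ Suc n = a ^ Suc n" "g * a * g ^ Suc n = g ^ Suc n"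
    using g(1,2) by (simp_all add: mult.assoc[symmetric])
  then show "is_group_inv (a ^ Suc n) (g ^ Suc n)"
    unfolding is_group_inv_def using idem comm g(3) by metis
qed

section \<open>Weighted EP elements through the spectral idempotent\<close>

text \<open>A weighted Moore-Penrose inverse that commutes with \<open>a\<close> is a group inverse, hence equal to
  \<open>g\<close>; so the two hermiticity requirements concern the one idempotent \<open>a * g = g * a\<close>.\<close>

lemma is_mp_inv_group_inv_iff:
  fixes a :: "'a::complex_banach_algebra"
  assumes "is_group_inv a g"
  shows "is_mp_inv e f a g \<longleftrightarrow> weighted_hermitian e (a * g) \<and> weighted_hermitian f (a * g)"
  using assms by (auto simp: is_mp_inv_def is_group_inv_def)

lemma weighted_EP_iff:
  fixes a :: "'a::complex_banach_algebra"
  assumes "alg_invertible e" "alg_invertible f" and g: "is_group_inv a g"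
  shows "weighted_EP e f a \<longleftrightarrow> weighted_hermitian e (a * g) \<and> weighted_hermitian f (a * g)"
proof
  assume "weighted_EP e f a"
  then have mp: "is_mp_inv e f a (mp_inv e f a)" and "a * mp_inv e f a = mp_inv e f a * a"
    using is_mp_inv_mp_inv[OF assms(1,2)] by (auto simp: weighted_EP_def)
  then have "is_group_inv a (mp_inv e f a)"
    by (simp add: is_mp_inv_def is_group_inv_def)
  then have "mp_inv e f a = g"
    using g by (rule is_group_inv_unique)
  then show "weighted_hermitian e (a * g) \<and> weighted_hermitian f (a * g)"
    using mp is_mp_inv_group_inv_iff[OF g] by simp
next
  assume "weighted_hermitian e (a * g) \<and> weighted_hermitian f (a * g)"
  then have mp: "is_mp_inv e f a g"
    by (simp add: is_mp_inv_group_inv_iff[OF g])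
  then have "mp_inv e f a = g"
    by (rule mp_inv_eqI[OF assms(1,2)])
  then show "weighted_EP e f a"
    using mp g by (auto simp: weighted_EP_def mp_invertible_def is_group_inv_def)
qed

lemma weighted_EP_imp_mp_inv_eq:
  fixes a :: "'a::complex_banach_algebra"
  assumes "alg_invertible e" "alg_invertible f" and g: "is_group_inv a g" and "weighted_EP e f a"
  shows "is_mp_inv e f a g" and "mp_inv e f a = g"
proof -
  show "is_mp_inv e f a g"
    using assms weighted_EP_iff is_mp_inv_group_inv_iff by metis
  then show "mp_inv e f a = g"
    by (rule mp_inv_eqI[OF assms(1,2)])
qed

section \<open>Comparing the two idempotents of a generalized inverse\<close>

text \<open>Here the range of \<open>p = ab\<close> lies in that of \<open>q = ba\<close>, and the kernel of \<open>q\<close> in that of \<open>p\<close>: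
  \<open>qp = p = pq\<close>. This alone does not force \<open>p = q\<close>, as a non-invertible element with a left
  inverse shows. But \<open>s = ag = ga\<close> has the kernel of \<open>q\<close> and the range of \<open>p\<close>, so that \<open>qs = q\<close> and
  \<open>ps = s\<close>. Since \<open>q\<close> acts as the identity on the range of \<open>p\<close>, also \<open>qs = s\<close>. Hence \<open>q = s\<close>, and
  \<open>p = pq = ps = s\<close>.\<close>

lemma commute_of_absorb_left:
  fixes a :: "'a::complex_banach_algebra"
  assumes b: "a * b * a = a" "b * a * b = b" and g: "is_group_inv a g"
    and 1: "b * a * a = a" and 2: "b * (b * a) = b"
  shows "a * b = b * a"
proof -
  note g = g[unfolded is_group_inv_def]
  have s: "a * b * (a * g) = a * g" "b * a * (a * g) = b * a"
    using b g by (metis mult.assoc)+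
  have "b * a * (a * g) = a * g"
    using 1 by (simp add: mult.assoc[symmetric])
  then have q: "b * a = a * g"
    using s(2) by simp
  have "a * b = a * b * (b * a)"
    using 2 by (simp add: mult.assoc)
  also have "\<dots> = a * g"
    using q s(1) by simp
  finally show ?thesis using q by simp
qed

text \<open>The mirror image, with \<open>pq = q = qp\<close>: here \<open>sp = p\<close> and \<open>sp = s\<close> give \<open>p = s\<close>, and then
  \<open>q = pq = sq = s\<close>.\<close>

lemma commute_of_absorb_right:
  fixes a :: "'a::complex_banach_algebra"
  assumes b: "a * b * a = a" "b * a * b = b" and g: "is_group_inv a g"
    and 1: "a * b * b = b" and 2: "a * (a * b) = a"
  shows "a * b = b * a"
proof -
  note g = g[unfolded is_group_inv_def]
  have s: "a * g * (b * a) = a * g" "a * g * (a * b) = a * b"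
    using b g by (metis mult.assoc)+
  have "a * g * (a * b) = a * g"
    using 2 g by (metis mult.assoc)
  then have p: "a * b = a * g"
    using s(2) by simp
  have "b * a = a * b * (b * a)"
    using 1 by (simp add: mult.assoc[symmetric])
  also have "\<dots> = a * g"
    using p s(1) by simp
  finally show ?thesis using p by simp
qed

section \<open>Ranges and null spaces of operators with a generalized inverse\<close>

lemma op_apply_mult: "op_apply (S * T) x = op_apply S (op_apply T x)"
  by (simp add: op_apply_def times_operator.rep_eq)

lemma op_apply_diff_right: "op_apply T (x - y) = op_apply T x - op_apply T y"
  by (simp add: op_apply_def blinfun.diff_right)

lemma op_apply_zero_right: "op_apply T 0 = 0"
  by (simp add: op_apply_def)

lemma op_eqI: "(\<And>x. op_apply S x = op_apply T x) \<Longrightarrow> S = T"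
  by (simp add: op_apply_def blinfun_eqI blinfun_of_operator_inject[symmetric])

text \<open>If \<open>SRS = S\<close>, then \<open>SR\<close> is idempotent with the range of \<open>S\<close>, and \<open>RS\<close> is idempotent with the
  kernel of \<open>S\<close>. This turns inclusions into equations in the algebra.\<close>

lemma op_range_subset_iff:
  assumes "S * R * S = S"
  shows "op_range T \<subseteq> op_range S \<longleftrightarrow> S * R * T = T"
proof
  assume sub: "op_range T \<subseteq> op_range S"
  show "S * R * T = T"
  proof (rule op_eqI)
    fix x
    obtain y where "op_apply T x = op_apply S y"
      using sub by (force simp: op_range_def)
    then show "op_apply (S * R * T) x = op_apply T x"
      using op_apply_mult[of "S * R" S y] assms by (simp add: op_apply_mult)
  qed
next
  assume "S * R * T = T"
  then have "op_apply T x = op_apply S (op_apply (R * T) x)" for x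
    by (simp add: mult.assoc flip: op_apply_mult)
  then show "op_range T \<subseteq> op_range S"
    by (auto simp: op_range_def)
qed

lemma op_null_subset_iff:
  assumes "S * R * S = S"
  shows "op_null S \<subseteq> op_null T \<longleftrightarrow> T * (R * S) = T"
proof
  assume sub: "op_null S \<subseteq> op_null T"
  show "T * (R * S) = T"
  proof (rule op_eqI)
    fix x
    have "op_apply S (x - op_apply (R * S) x) = 0"
      using assms by (simp add: op_apply_diff_right mult.assoc flip: op_apply_mult)
    then have "op_apply T (x - op_apply (R * S) x) = 0"
      using sub by (auto simp: op_null_def)
    then show "op_apply (T * (R * S)) x = op_apply T x"
      by (simp add: op_apply_diff_right op_apply_mult)
  qed
next
  assume "T * (R * S) = T"
  then have "op_apply T x = op_apply (T * R) (op_apply S x)" for x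
    by (simp add: mult.assoc flip: op_apply_mult)
  then show "op_null S \<subseteq> op_null T"
    by (auto simp: op_null_def op_apply_zero_right)
qed

section \<open>Characterizations of weighted EP operators\<close>

theorem theorem3p5:
  fixes E F T :: "'x::complex_banach operator"
  assumes "alg_invertible E" and "positive_elem E"
    and "alg_invertible F" and "positive_elem F"
    and "mp_invertible E F T" and "group_invertible T"
  shows
    "\<comment> \<open>(i) iff (ii)\<close>
     (weighted_EP E F T \<longleftrightarrow>
        op_range (mp_inv E F T) = op_range T \<and> op_null (mp_inv E F T) = op_null T) \<and>
    \<comment> \<open>(iii)\<close>
     (weighted_EP E F T \<longleftrightarrow>
        op_range (mp_inv E F T) \<subseteq> op_range T \<and> op_null T \<subseteq> op_null (mp_inv E F T)) \<and>
    \<comment> \<open>(iv)\<close>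
     (weighted_EP E F T \<longleftrightarrow>
        op_range T \<subseteq> op_range (mp_inv E F T) \<and> op_null T \<subseteq> op_null (mp_inv E F T)) \<and>
    \<comment> \<open>(v)\<close>
     (weighted_EP E F T \<longleftrightarrow>
        op_range (mp_inv E F T) \<subseteq> op_range T \<and> op_null (mp_inv E F T) \<subseteq> op_null T) \<and>
    \<comment> \<open>(vi)\<close>
     (weighted_EP E F T \<longleftrightarrow>
        op_range T \<subseteq> op_range (mp_inv E F T) \<and> op_null (mp_inv E F T) \<subseteq> op_null T) \<and>
    \<comment> \<open>(vii)\<close>
     (weighted_EP E F T \<longleftrightarrow> mp_inv E F T = group_inv T) \<and>
    \<comment> \<open>(viii)\<close>
     (weighted_EP E F T \<longleftrightarrow>
        mp_inv E F T = T * (mp_inv E F T)^2 \<and> T * (mp_inv E F T)^2 = (mp_inv E F T)^2 * T) \<and>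
    \<comment> \<open>(ix)\<close>
     (weighted_EP E F T \<longleftrightarrow>
        T = mp_inv E F T * T^2 \<and> mp_inv E F T * T^2 = T^2 * mp_inv E F T) \<and>
    \<comment> \<open>(x)\<close>
     (weighted_EP E F T \<longleftrightarrow>
        weighted_EP F E (mp_inv E F T) \<and> mp_inv F E (mp_inv E F T) = T) \<and>
    \<comment> \<open>(xi)\<close>
     (weighted_EP E F T \<longleftrightarrow> weighted_EP F E T) \<and>
    \<comment> \<open>(xii)\<close>
     (weighted_EP E F T \<longleftrightarrow> weighted_EP E E T \<and> weighted_EP F F T) \<and>
    \<comment> \<open>(xiii)\<close>
     (weighted_EP E F T \<longleftrightarrow> (\<exists>k::nat. k \<ge> 1 \<and> weighted_EP E F (T ^ k))) \<and>
    \<comment> \<open>(xiv)\<close>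
     (weighted_EP E F T \<longleftrightarrow> weighted_EP E F (group_inv T)) \<and>
    \<comment> \<open>(xv), both forms\<close>
     (weighted_EP E F T \<longleftrightarrow>
        mp_invertible E E T \<and> mp_invertible F F T \<and>
        T * group_inv T = T * mp_inv E E T \<and> T * mp_inv E E T = T * mp_inv F F T) \<and>
     (weighted_EP E F T \<longleftrightarrow>
        mp_invertible E E T \<and> mp_invertible F F T \<and>
        T * group_inv T = mp_inv E E T * T \<and> mp_inv E E T * T = mp_inv F F T * T) \<and>
    \<comment> \<open>(xvi), both forms\<close>
     (weighted_EP E F T \<longleftrightarrow>
        mp_invertible F E T \<and>
        T * group_inv T = T * mp_inv E F T \<and> T * mp_inv E F T = T * mp_inv F E T) \<and>
     (weighted_EP E F T \<longleftrightarrow>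
        mp_invertible F E T \<and>
        T * group_inv T = mp_inv F E T * T \<and> mp_inv F E T * T = mp_inv E F T * T)"
proof -
  note EF = assms(1,3)
  define B where "B = mp_inv E F T"
  define G where "G = group_inv T"
  have mp: "is_mp_inv E F T B"
    unfolding B_def by (rule is_mp_inv_mp_inv[OF EF assms(5)])
  then have B: "T * B * T = T" "B * T * B = B"
    by (simp_all add: is_mp_inv_def)
  have GI: "is_group_inv T G"
    using assms(6) group_inv_eqI unfolding G_def group_invertible_def by metis
  then have G: "T * G * T = T" "G * T * G = G" "T * G = G * T"
    unfolding is_group_inv_def by blast+
  let ?H = "\<lambda>u. weighted_hermitian u (T * G)"
  have EP_comm: "weighted_EP E F T \<longleftrightarrow> T * B = B * T"
    using assms(5) by (simp add: weighted_EP_def B_def)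
  have EP_eq: "B = G" if "weighted_EP E F T"
    using weighted_EP_imp_mp_inv_eq(2)[OF EF GI that] by (simp add: B_def)
  have EP_H: "weighted_EP e f T \<longleftrightarrow> ?H e \<and> ?H f" if "alg_invertible e" "alg_invertible f" for e f
    by (rule weighted_EP_iff[OF that GI])
  have mp_H: "is_mp_inv e f T (mp_inv e f T)"
    if "alg_invertible e" "alg_invertible f" "mp_invertible e f T" for e f
    by (rule is_mp_inv_mp_inv[OF that])
  have H_mp: "mp_invertible e f T" "mp_inv e f T = G"
    if "alg_invertible e" "alg_invertible f" "?H e" "?H f" for e f
    using weighted_EP_imp_mp_inv_eq[OF that(1,2) GI] EP_H that by (auto simp: mp_invertible_def)

  \<comment> \<open>The four inclusions, read as equations between \<open>T\<close> and \<open>B\<close>.\<close>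
  have incl: "op_range B \<subseteq> op_range T \<longleftrightarrow> T * B * B = B" "op_range T \<subseteq> op_range B \<longleftrightarrow> B * T * T = T"
    "op_null T \<subseteq> op_null B \<longleftrightarrow> B * (B * T) = B" "op_null B \<subseteq> op_null T \<longleftrightarrow> T * (T * B) = T"
    using B op_range_subset_iff op_null_subset_iff by blast+
  have EP_incl: "T * B * B = B \<and> B * T * T = T \<and> B * (B * T) = B \<and> T * (T * B) = T"
    if "weighted_EP E F T"
    using B that unfolding EP_comm by (simp add: mult.assoc[symmetric]) (metis mult.assoc)
  have iii: "weighted_EP E F T" if "T * B * B = B" "B * (B * T) = B"
    unfolding EP_comm using that by (metis mult.assoc)
  have iv: "weighted_EP E F T" if "B * T * T = T" "B * (B * T) = B"
    unfolding EP_comm by (rule commute_of_absorb_left[OF B GI that])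
  have v: "weighted_EP E F T" if "T * B * B = B" "T * (T * B) = T"
    unfolding EP_comm by (rule commute_of_absorb_right[OF B GI that])
  have vi: "weighted_EP E F T" if "B * T * T = T" "T * (T * B) = T"
    unfolding EP_comm using that by (metis mult.assoc)

  have c2: "weighted_EP E F T \<longleftrightarrow> op_range B = op_range T \<and> op_null B = op_null T"
    using EP_incl iii unfolding set_eq_subset incl by blast
  have c3: "weighted_EP E F T \<longleftrightarrow> op_range B \<subseteq> op_range T \<and> op_null T \<subseteq> op_null B"
    using EP_incl iii unfolding incl by blast
  have c4: "weighted_EP E F T \<longleftrightarrow> op_range T \<subseteq> op_range B \<and> op_null T \<subseteq> op_null B"
    using EP_incl iv unfolding incl by blast
  have c5: "weighted_EP E F T \<longleftrightarrow> op_range B \<subseteq> op_range T \<and> op_null B \<subseteq> op_null T"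
    using EP_incl v unfolding incl by blast
  have c6: "weighted_EP E F T \<longleftrightarrow> op_range T \<subseteq> op_range B \<and> op_null B \<subseteq> op_null T"
    using EP_incl vi unfolding incl by blast
  have c7: "weighted_EP E F T \<longleftrightarrow> B = G"
    using EP_eq EP_comm G(3) by blast
  have "T * B ^ 2 = T * B * B" "B ^ 2 * T = B * (B * T)"
    "B * T ^ 2 = B * T * T" "T ^ 2 * B = T * (T * B)"
    by (simp_all add: power2_eq_square mult.assoc)
  then have c8: "weighted_EP E F T \<longleftrightarrow> B = T * B ^ 2 \<and> T * B ^ 2 = B ^ 2 * T"
    and c9: "weighted_EP E F T \<longleftrightarrow> T = B * T ^ 2 \<and> B * T ^ 2 = T ^ 2 * B"
    using EP_incl iii vi by metis+

  have GI': "is_group_inv G T"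
    using G unfolding is_group_inv_def by metis
  have c10: "weighted_EP E F T \<longleftrightarrow> weighted_EP F E B \<and> mp_inv F E B = T"
  proof
    assume ep: "weighted_EP E F T"
    then have "?H F" "?H E" using EP_H EF by blast+
    then have "weighted_EP F E G"
      using weighted_EP_iff[OF EF(2,1) GI'] G(3) by simp
    then show "weighted_EP F E B \<and> mp_inv F E B = T"
      using weighted_EP_imp_mp_inv_eq(2)[OF EF(2,1) GI'] EP_eq[OF ep] by simp
  next
    assume "weighted_EP F E B \<and> mp_inv F E B = T"
    then show "weighted_EP E F T"
      unfolding EP_comm by (auto simp: weighted_EP_def)
  qed
  have c11: "weighted_EP E F T \<longleftrightarrow> weighted_EP F E T"
    using EP_H EF by blast
  have c12: "weighted_EP E F T \<longleftrightarrow> weighted_EP E E T \<and> weighted_EP F F T"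
    using EP_H EF by blast
  have "weighted_EP E F (T ^ k) \<longleftrightarrow> weighted_EP E F T" if "k \<ge> 1" for k
  proof -
    from \<open>k \<ge> 1\<close> obtain n where "k = Suc n" by (cases k) auto
    then show ?thesis
      using weighted_EP_iff[OF EF is_group_inv_power(1)[OF GI]] is_group_inv_power(2)[OF GI] EP_H EF
      by metis
  qed
  then have c13: "weighted_EP E F T \<longleftrightarrow> (\<exists>k::nat. k \<ge> 1 \<and> weighted_EP E F (T ^ k))"
    by blast
  have c14: "weighted_EP E F T \<longleftrightarrow> weighted_EP E F G"
    using weighted_EP_iff[OF EF GI'] EP_H EF G(3) by simp

  \<comment> \<open>In each alternative the two equations identify \<open>T * G\<close> with an idempotent that is hermitian
    for \<open>E\<close> and with one that is hermitian for \<open>F\<close>.\<close>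
  have c15: "weighted_EP E F T \<longleftrightarrow> mp_invertible E E T \<and> mp_invertible F F T \<and>
      T * G = T * mp_inv E E T \<and> T * mp_inv E E T = T * mp_inv F F T"
    using EP_H EF H_mp mp_H unfolding is_mp_inv_def by metis
  have c15': "weighted_EP E F T \<longleftrightarrow> mp_invertible E E T \<and> mp_invertible F F T \<and>
      T * G = mp_inv E E T * T \<and> mp_inv E E T * T = mp_inv F F T * T"
    using EP_H EF H_mp mp_H G(3) unfolding is_mp_inv_def by metis
  have c16: "weighted_EP E F T \<longleftrightarrow> mp_invertible F E T \<and>
      T * G = T * mp_inv E F T \<and> T * mp_inv E F T = T * mp_inv F E T"
    using EP_H EF H_mp mp_H assms(5) unfolding is_mp_inv_def by metis
  have c16': "weighted_EP E F T \<longleftrightarrow> mp_invertible F E T \<and>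
      T * G = mp_inv F E T * T \<and> mp_inv F E T * T = mp_inv E F T * T"
    using EP_H EF H_mp mp_H assms(5) G(3) unfolding is_mp_inv_def by metis

  show ?thesis
    unfolding B_def[symmetric] G_def[symmetric]
    by (intro conjI c2 c3 c4 c5 c6 c7 c8 c9 c10 c11 c12 c13 c14 c15 c15' c16[folded B_def] c16'[folded B_def])
qed

end
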